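(* Let $q$ be a prime power, let $m,n$ be positive integers, and let $X$ be a vector space over $\mathbb{F}_q$ of dimension $mn\ge 2$. Let $\mathcal{A}$ be a partial $m$-spread of $X$, let $h$ be a positive integer with $1\leq h\leq m$, and let $U$ be an $\mathbb{F}_q$-subspace of $X$. If $U$ is $(\mathcal{A},h)$-evasive, then $$\dim_{\mathbb{F}_q}(U)\leq m(n-1)+h.$$ Furthermore, equality is possible only if $|\mathcal{A}|\leq q^{m(n-1)}$. In particular, if $\mathcal{A}$ is an $m$-spread of $X$, then $$\dim_{\mathbb{F}_q}(U)\leq m(n-1)+h-1.$$
   Context: A collection $\mathcal{A}$ of $m$-dimensional $\mathbb{F}_q$-subspaces of $X$ is a partial $m$-spread if $S\cap S'=\{0\}$ for all distinct $S,S'\in\mathcal{A}$; it is an $m$-spread if moreover every non-zero vector of $X$ lies in exactly one element of $\mathcal{A}$. An $\mathbb{F}_q$-subspace $U\le X$ is $(\mathcal{A},h)$-evasive if $\dim_{\mathbb{F}_q}(U\cap S)\leq h$ for all $S\in\mathcal{A}$.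
   Formalization: Side conditions added where the claim fails: the first bound needs A non-empty or h = m; the equality clause needs h < m or n = 1 (U = X with h = m breaks it); the m-spread clause needs n ≥ 2 and (h < m or U ≠ X). *)

theory Defs
  imports Complex_Main "HOL-Library.Cardinality"
begin

text \<open>The ambient space $X$ is the whole type of vectors, and the scalar multiplication is the
  explicit argument \<open>scale\<close>, meant to satisfy \<^locale>\<open>vector_space\<close>.\<close>

definition partial_spread ::
    "('f::field \<Rightarrow> 'v::ab_group_add \<Rightarrow> 'v) \<Rightarrow> nat \<Rightarrow> 'v set set \<Rightarrow> bool" where
  "partial_spread scale m \<A> \<longleftrightarrow>
     (\<forall>S\<in>\<A>. module.subspace scale S \<and> vector_space.dim scale S = m) \<and>
     (\<forall>S\<in>\<A>. \<forall>S'\<in>\<A>. S \<noteq> S' \<longrightarrow> S \<inter> S' = {0})"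

definition spread ::
    "('f::field \<Rightarrow> 'v::ab_group_add \<Rightarrow> 'v) \<Rightarrow> nat \<Rightarrow> 'v set set \<Rightarrow> bool" where
  "spread scale m \<A> \<longleftrightarrow>
     partial_spread scale m \<A> \<and> (\<forall>v. v \<noteq> 0 \<longrightarrow> (\<exists>!S. S \<in> \<A> \<and> v \<in> S))"

definition evasive ::
    "('f::field \<Rightarrow> 'v::ab_group_add \<Rightarrow> 'v) \<Rightarrow> 'v set set \<Rightarrow> nat \<Rightarrow> 'v set \<Rightarrow> bool" where
  "evasive scale \<A> h U \<longleftrightarrow>
     module.subspace scale U \<and> (\<forall>S\<in>\<A>. vector_space.dim scale (U \<inter> S) \<le> h)"

end

theory Submission
  imports Defs "HOL-Library.FuncSet"
begin

text \<open>The dimension bound is Grassmann's formula for \<open>U\<close> and one element of the partial spread. If it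
  is attained with \<open>h < m\<close>, every element \<open>S\<close> meets \<open>U\<close> in dimension exactly \<open>h\<close>, so the sets \<open>S - U\<close>
  are pairwise disjoint subsets of the complement of \<open>U\<close>, of size \<open>q\<^sup>m - q\<^sup>h\<close> each. The complement has
  size \<open>q\<^bsup>m(n-1)\<^esup> (q\<^sup>m - q\<^sup>h)\<close>, whence at most \<open>q\<^bsup>m(n-1)\<^esup>\<close> elements. For \<open>n \<ge> 2\<close> a spread has more
  elements than that.\<close>

lemma one_less_card_UNIV:
  assumes "finite (UNIV :: 'a::zero_neq_one set)"
  shows "1 < CARD('a)"
proof -
  have "card {0, 1 :: 'a} \<le> CARD('a)"
    using assms by (intro card_mono) auto
  then show ?thesis
    by simp
qed

text \<open>Coefficient families are taken extensional on \<open>B\<close>, so linear independence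
  makes \<open>f\<close> a bijection from \<open>B \<rightarrow>\<^sub>E UNIV\<close> onto the
  span.\<close>

lemma (in vector_space) card_span_independent:
  assumes fin: "finite (UNIV :: 'a set)" and finB: "finite B" and B: "independent B"
  shows "finite (span B)" "card (span B) = CARD('a) ^ card B"
proof -
  define f where "f u = (\<Sum>v\<in>B. u v *s v)" for u
  have inj: "inj_on f (B \<rightarrow>\<^sub>E UNIV)"
  proof (rule inj_onI)
    fix u w assume u: "u \<in> B \<rightarrow>\<^sub>E UNIV" and w: "w \<in> B \<rightarrow>\<^sub>E UNIV" and eq: "f u = f w"
    have "(\<Sum>v\<in>B. (u v - w v) *s v) = 0"
      using eq by (simp add: f_def scale_left_diff_distrib sum_subtractf)
    then have "u v = w v" if "v \<in> B" for v
      using independentD[OF B finB order_refl, of "\<lambda>v. u v - w v" v] that by simp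
    with u w show "u = w"
      by (rule PiE_ext)
  qed
  have img: "span B = f ` (B \<rightarrow>\<^sub>E UNIV)"
  proof
    show "span B \<subseteq> f ` (B \<rightarrow>\<^sub>E UNIV)"
    proof
      fix x assume "x \<in> span B"
      then obtain u where "x = f u"
        by (auto simp: span_finite[OF finB] f_def)
      then have "x = f (restrict u B)"
        by (simp add: f_def)
      then show "x \<in> f ` (B \<rightarrow>\<^sub>E UNIV)"
        by (simp add: image_eqI[of _ f "restrict u B"])
    qed
  qed (auto simp: span_finite[OF finB] f_def)
  show "finite (span B)"
    unfolding img using finB fin by (simp add: finite_PiE)
  show "card (span B) = CARD('a) ^ card B"
    unfolding img card_image[OF inj] using finB by (rule card_funcsetE)
qed

context finite_dimensional_vector_space
begin

lemma finite_UNIV_vectors: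
  assumes "finite (UNIV :: 'a set)"
  shows "finite (A :: 'b set)"
  by (rule finite_subset[OF _ card_span_independent(1)[OF assms finite_Basis independent_Basis]])
    (simp add: span_Basis)

lemma card_subspace:
  assumes "finite (UNIV :: 'a set)" and S: "subspace S"
  shows "card S = CARD('a) ^ dim S"
proof -
  obtain B where "B \<subseteq> S" "independent B" "S \<subseteq> span B" "card B = dim S"
    by (rule basis_exists)
  moreover from this have "span B = S"
    using S span_minimal by blast
  ultimately show ?thesis
    using card_span_independent(2)[OF assms(1) finiteI_independent, of B] by simp
qed

lemma dim_Int_ge:
  assumes "subspace S" "subspace T"
  shows "dim S + dim T \<le> dim UNIV + dim (S \<inter> T)"
  unfolding dim_sums_Int[OF assms, symmetric]
  by (intro add_right_mono dim_subset subset_UNIV)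

lemma evasive_dim_le:
  assumes "partial_spread scale m \<A>" "evasive scale \<A> h U" "\<A> \<noteq> {}"
  shows "dim U + m \<le> dim UNIV + h"
proof -
  obtain S where "S \<in> \<A>"
    using assms(3) by blast
  with assms have "subspace U" "subspace S" "dim S = m" "dim (U \<inter> S) \<le> h"
    by (auto simp: partial_spread_def evasive_def)
  with dim_Int_ge[of U S] show ?thesis
    by linarith
qed

text \<open>Used with \<open>W = U\<close> to count outside \<open>U\<close>, and with
  \<open>W = {0}\<close> to count the non-zero vectors.\<close>

lemma partial_spread_disjoint:
  assumes "partial_spread scale m \<A>" "0 \<in> W"
  shows "\<forall>S\<in>\<A>. \<forall>T\<in>\<A>. S \<noteq> T \<longrightarrow> (S - W) \<inter> (T - W) = {}"
proof (intro ballI impI)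
  fix S T assume "S \<in> \<A>" "T \<in> \<A>" "S \<noteq> T"
  with assms(1) have "S \<inter> T = {0}"
    by (simp add: partial_spread_def)
  with assms(2) have "S \<inter> T - W = {}"
    by simp
  then show "(S - W) \<inter> (T - W) = {}"
    by blast
qed

lemma card_evasive_extremal:
  assumes fin: "finite (UNIV :: 'a set)"
    and ps: "partial_spread scale m \<A>" and ev: "evasive scale \<A> h U"
    and dimU: "dim U = k + h" and dimX: "dim UNIV = k + m" and "h < m"
  shows "card \<A> \<le> CARD('a) ^ k"
proof -
  define q where "q = CARD('a)"
  have q: "1 < q"
    unfolding q_def using fin by (rule one_less_card_UNIV)
  have U: "subspace U"
    using ev by (simp add: evasive_def)
  have finA: "finite A" for A :: "'b set"
    using fin by (rule finite_UNIV_vectors)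
  have fin\<A>: "finite \<A>"
    by (rule finite_subset[OF subset_UNIV]) (simp add: Finite_Set.finite_set finA)
  have each: "card (S - U) = q ^ m - q ^ h" if "S \<in> \<A>" for S
  proof -
    have S: "subspace S" "dim S = m" and le: "dim (U \<inter> S) \<le> h"
      using that ps ev by (auto simp: partial_spread_def evasive_def)
    \<comment> \<open>Grassmann gives the lower bound (k + h) + m - (k + m) = h; evasiveness gives
      the upper one.\<close>
    have "dim (U \<inter> S) = h"
      using dim_Int_ge[OF U S(1)] le S(2) dimU dimX by linarith
    then have "card (S \<inter> U) = q ^ h"
      using card_subspace[OF fin subspace_inter[OF U S(1)]] by (simp add: q_def Int_commute)
    then show ?thesis
      using card_subspace[OF fin S(1)] S(2) finA by (simp add: card_Diff_subset_Int q_def)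
  qed
  have "card \<A> * (q ^ m - q ^ h) = card (\<Union>S\<in>\<A>. S - U)"
    using card_UN_disjoint[OF fin\<A> _ partial_spread_disjoint[OF ps subspace_0[OF U]]] each
    by (simp add: finA)
  also have "\<dots> \<le> card (UNIV - U)"
    by (rule card_mono) (auto simp: finA)
  also have "\<dots> = q ^ (k + m) - q ^ (k + h)"
    using card_subspace[OF fin subspace_UNIV] card_subspace[OF fin U] dimU dimX finA
    by (simp add: card_Diff_subset q_def)
  also have "\<dots> = q ^ k * (q ^ m - q ^ h)"
    by (simp add: power_add diff_mult_distrib2)
  \<comment> \<open>Since h < m, the common factor \<open>q ^ m - q ^ h\<close> is positive and
    cancels.\<close>
  finally show ?thesis
    using power_strict_increasing[OF \<open>h < m\<close> q] by (simp add: q_def)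
qed

text \<open>The sets \<open>S - {0}\<close> partition the non-zero vectors. The product form avoids
  a division.\<close>

lemma card_spread:
  assumes fin: "finite (UNIV :: 'a set)" and sp: "spread scale m \<A>"
  shows "card \<A> * (CARD('a) ^ m - 1) = CARD('a) ^ dim UNIV - 1"
proof -
  have finA: "finite A" for A :: "'b set"
    using fin by (rule finite_UNIV_vectors)
  have fin\<A>: "finite \<A>"
    by (rule finite_subset[OF subset_UNIV]) (simp add: Finite_Set.finite_set finA)
  have ps: "partial_spread scale m \<A>"
    using sp by (simp add: spread_def)
  have each: "card (S - {0}) = CARD('a) ^ m - 1" if "S \<in> \<A>" for S
    using that ps card_subspace[OF fin, of S] subspace_0[of S] finA
    by (simp add: partial_spread_def)
  have "card (UNIV - {0 :: 'b}) = CARD('a) ^ dim UNIV - 1"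
    using card_subspace[OF fin subspace_UNIV] finA by simp
  moreover have "UNIV - {0} = (\<Union>S\<in>\<A>. S - {0})"
    using sp by (auto simp: spread_def)
  moreover have "card (\<Union>S\<in>\<A>. S - {0}) = card \<A> * (CARD('a) ^ m - 1)"
    using card_UN_disjoint[OF fin\<A> _ partial_spread_disjoint[OF ps, of "{0}"]] each
    by (simp add: finA)
  ultimately show ?thesis
    by simp
qed

text \<open>By \<open>card_spread\<close>, at most q^k elements would cover at most q^(k+m) - q^k
  non-zero vectors, fewer than q^(k+m) - 1 because k > 0.\<close>

lemma card_spread_gt:
  assumes fin: "finite (UNIV :: 'a set)" and sp: "spread scale m \<A>"
    and dimX: "dim UNIV = k + m" and "0 < k"
  shows "CARD('a) ^ k < card \<A>"
proof (rule ccontr)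
  define q where "q = CARD('a)"
  assume "\<not> ?thesis"
  then have "card \<A> * (q ^ m - 1) \<le> q ^ k * (q ^ m - 1)"
    by (simp add: q_def)
  then have le: "q ^ (k + m) - 1 \<le> q ^ (k + m) - q ^ k"
    using card_spread[OF fin sp] dimX by (simp add: q_def power_add diff_mult_distrib2)
  have q: "1 < q"
    unfolding q_def using fin by (rule one_less_card_UNIV)
  \<comment> \<open>The second inequality keeps the subtraction in \<open>le\<close> from being
    truncated.\<close>
  have "1 < q ^ k" "q ^ k \<le> q ^ (k + m)"
    using q \<open>0 < k\<close> by (auto intro: one_less_power simp del: One_nat_def)
  with le show False
    by linarith
qed

end

text \<open>The side conditions exclude degenerate cases. If \<A> is empty and h < m, the whole
  space X is evasive and exceeds the bound. If h = m, X is evasive and attains the bound for every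
  \<A>, including spreads with n \<ge> 2. If n = 1, {X} is a spread and any h-dimensional U attains
  the bound.\<close>

theorem theorem3p1:
  fixes scale :: "'f::{field,finite} \<Rightarrow> 'v::ab_group_add \<Rightarrow> 'v"
    and q m n h :: nat
    and \<A> :: "'v set set"
    and U :: "'v set"
  assumes "vector_space scale"
    and "CARD('f) = q"
    and "m \<ge> 1" and "n \<ge> 1"
    and "vector_space.dim scale (UNIV :: 'v set) = m * n"
    and "m * n \<ge> 2"
    and "partial_spread scale m \<A>"
    and "1 \<le> h" and "h \<le> m"
    and "module.subspace scale U"
    and "evasive scale \<A> h U"
  shows "(\<A> \<noteq> {} \<or> h = m \<longrightarrow> vector_space.dim scale U \<le> m * (n - 1) + h) \<and>
         (h < m \<or> n = 1 \<longrightarrow> vector_space.dim scale U = m * (n - 1) + h \<longrightarrow> card \<A> \<le> q ^ (m * (n - 1))) \<and>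
         (n \<ge> 2 \<and> (h < m \<or> U \<noteq> UNIV) \<longrightarrow> spread scale m \<A> \<longrightarrow>
            vector_space.dim scale U \<le> m * (n - 1) + h - 1)"
proof -
  interpret V: vector_space scale by fact
  obtain B where B: "V.independent B" "UNIV \<subseteq> V.span B" "card B = V.dim (UNIV :: 'v set)"
    using V.basis_exists by metis
  \<comment> \<open>A positive \<open>dim\<close> forces a finite basis, since \<open>card\<close> of an infinite set is 0.\<close>
  have "finite B"
    using B(3) assms(5,6) by (intro card_ge_0_finite) linarith
  then interpret V: finite_dimensional_vector_space scale B
    by unfold_locales (use B in auto)
  have fin: "finite (UNIV :: 'f set)"
    by simp
  define k where "k = m * (n - 1)"
  have dimX: "V.dim (UNIV :: 'v set) = k + m"
    using assms(4,5) by (cases n) (auto simp: k_def)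
  \<comment> \<open>For h = m the right-hand side is the dimension of the whole space.\<close>
  have bound: "V.dim U \<le> k + h" if "\<A> \<noteq> {} \<or> h = m"
    using that V.evasive_dim_le[OF assms(7,11)] V.dim_subset[OF subset_UNIV, of U] dimX by auto
  have extremal: "card \<A> \<le> q ^ k" if "h < m" "V.dim U = k + h"
    using V.card_evasive_extremal[OF fin assms(7,11) that(2) dimX that(1)] assms(2) by simp
  have card: "card \<A> \<le> q ^ k" if "h < m \<or> n = 1" "V.dim U = k + h"
  proof (cases "h < m")
    case True
    then show ?thesis
      using extremal that(2) by blast
  next
    case False
    with that have "k = 0"
      by (simp add: k_def)
    \<comment> \<open>Here n = 1, so each element has full dimension and \<A> has at most 1 = q^0
      elements.\<close>
    have "S = UNIV" if "S \<in> \<A>" for S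
      using that assms(7) dimX \<open>k = 0\<close> V.subspace_dim_equal[OF _ V.subspace_UNIV, of S]
      by (auto simp: partial_spread_def)
    then have "card \<A> \<le> card {UNIV :: 'v set}"
      by (intro card_mono) auto
    then show ?thesis
      by (simp add: \<open>k = 0\<close>)
  qed
  have strict: "V.dim U < k + h"
    if "n \<ge> 2" "h < m \<or> U \<noteq> UNIV" "spread scale m \<A>"
  proof (cases "h < m")
    case True
    have gt: "q ^ k < card \<A>"
      using V.card_spread_gt[OF fin that(3) dimX] that(1) assms(2,3) by (simp add: k_def)
    then have "V.dim U \<noteq> k + h"
      using extremal True by force
    moreover have "\<A> \<noteq> {}"
      using gt by auto
    ultimately show ?thesis
      using bound by force
  next
    case False
    with that(2) assms(9) have "h = m" "U \<noteq> UNIV"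
      by auto
    \<comment> \<open>Now k + h is the full dimension, which a proper subspace cannot reach.\<close>
    then show ?thesis
      using V.subspace_dim_equal[OF assms(10) V.subspace_UNIV] dimX by force
  qed
  show ?thesis
    using bound card strict by (fold k_def) force
qed

end
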